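(* Let $k,q\in\mathbb N=\{1,2,\ldots\}$ with $k$ odd, let $m,n\in\mathbb N_0=\{0,1,2,\ldots\}$ with $m+n>0$, and let $a$ be a number. Then $$(-1)^{m}\sum_{i=0}^{m+q}\binom{m+q}i \binom{n+q+i}k E_{n+q+i-k}(a)+(-1)^{n}\sum_{j=0}^{n+q}\binom{n+q}j\binom{m+q+j}k E_{m+q+j-k}(-a)=0.$$
   Context: The Euler polynomials $E_n(a)$, $n\in\mathbb N_0$, are defined by the generating function $\frac{2e^{at}}{e^t+1}=\sum_{n=0}^\infty E_n(a)\frac{t^n}{n!}$. $\binom{N}{k}$ is the usual binomial coefficient, equal to $0$ when $k>N$; any term whose binomial coefficient vanishes (in particular any term in which an Euler polynomial would have negative index) is interpreted as $0$. *)

theory Defs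
  imports Complex_Main "HOL-Computational_Algebra.Formal_Power_Series"
begin

(* The value E_n(a), read off from the generating function
     2 e^{a t} / (e^t + 1) = sum_n E_n(a) t^n / n!
   as an identity of formal power series in t; the denominator has constant
   term 2, so it is a unit and the quotient is the genuine one
   (see euler_poly_generating_function). *)
definition euler_poly :: "nat \<Rightarrow> 'a::field_char_0 \<Rightarrow> 'a" where
  "euler_poly n a = fact n * fps_nth (2 * fps_exp a / (fps_exp 1 + 1)) n"

lemma euler_poly_generating_function:
  fixes a :: "'a::field_char_0"
  shows "Abs_fps (\<lambda>n. euler_poly n a / fact n) * (fps_exp 1 + 1) = 2 * fps_exp a"
proof -
  have unit: "fps_nth (fps_exp 1 + 1 :: 'a fps) 0 \<noteq> 0"
    by simp
  have "Abs_fps (\<lambda>n. euler_poly n a / fact n) = 2 * fps_exp a / (fps_exp 1 + 1)"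
    by (simp add: fps_eq_iff euler_poly_def)
  also have "\<dots> * (fps_exp 1 + 1) = 2 * fps_exp a"
    using unit by (simp add: fps_divide_unit mult.assoc inverse_mult_eq_1)
  finally show ?thesis .
qed

end

(* Let L_a be the linear functional on polynomials with L_a (x^n) = E_n(a).  The reflection formula
   E_n(-a) = (-1)^n E_n(a + 1) says L_(-a) p = L_a (p o (-1 - x)).  Up to the factor k!, the two sums
   are L_a and L_(-a) applied to the k-th derivatives of x^N (1 + x)^M and x^M (1 + x)^N, where
   M = m + q and N = n + q.  The substitution x -> -1 - x exchanges these two polynomials up to the
   sign (-1)^(M + N), and the k-th derivative contributes (-1)^k = -1. *)
theory Submission
  imports Defs "HOL-Computational_Algebra.Polynomial"
begin

lemma fps_exp_plus_1_nonzero: "fps_exp c + 1 \<noteq> (0 :: 'a::field_char_0 fps)"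
proof -
  have "fps_nth (fps_exp c + 1 :: 'a fps) 0 \<noteq> 0"
    by simp
  then show ?thesis
    by (metis fps_zero_nth)
qed

text \<open>Replacing t by -t in the generating function for -a gives 2 e^(at) / (e^(-t) + 1), which
  is e^t times the one for a. The binomial convolution with e^t on the right is E_n(a + 1) written
  in terms of the values at a.\<close>

lemma euler_poly_minus:
  fixes a :: "'a::field_char_0"
  shows "euler_poly n (- a) = (- 1) ^ n * (\<Sum>i\<le>n. of_nat (n choose i) * euler_poly i a)"
proof -
  define G :: "'a \<Rightarrow> 'a fps" where "G b = Abs_fps (\<lambda>n. euler_poly n b / fact n)" for b
  have G: "G b * (fps_exp 1 + 1) = 2 * fps_exp b" for b
    unfolding G_def by (rule euler_poly_generating_function)
  define H where "H = G (- a) oo (- fps_X)"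
  have "(G (- a) * (fps_exp 1 + 1)) oo (- fps_X) = H * (fps_exp (- 1) + 1)"
    by (simp add: H_def fps_compose_mult_distrib fps_compose_add_distrib)
  moreover have "(2 * fps_exp (- a)) oo (- fps_X) = 2 * fps_exp a"
    by (simp add: fps_compose_mult_distrib)
  ultimately have H: "H * (fps_exp (- 1) + 1) = 2 * fps_exp a"
    by (simp add: G)
  have inv: "fps_exp (- 1) * fps_exp 1 = (1 :: 'a fps)"
    by (simp flip: fps_exp_add_mult)
  have "H * (fps_exp 1 + 1) = (H * (fps_exp (- 1) + 1)) * fps_exp 1"
    using inv by (simp add: algebra_simps)
  also have "\<dots> = (G a * fps_exp 1) * (fps_exp 1 + 1)"
    by (simp add: H G mult_ac flip: G[of a])
  \<comment> \<open>The common factor e^t + 1 is nonzero, so it cancels in the integral domain of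
    power series.\<close>
  finally have "H = G a * fps_exp 1"
    by (simp add: fps_exp_plus_1_nonzero)
  then have "fps_nth H n = fps_nth (G a * fps_exp 1) n"
    by simp
  then have "(- 1) ^ n * (euler_poly n (- a) / fact n)
      = (\<Sum>i\<le>n. euler_poly i a / (fact i * fact (n - i)))"
    by (simp add: H_def fps_compose_uminus' G_def fps_mult_nth atLeast0AtMost)
  then have "(- 1) ^ n * euler_poly n (- a)
      = fact n * (\<Sum>i\<le>n. euler_poly i a / (fact i * fact (n - i)))"
    by (simp add: field_simps)
  also have "\<dots> = (\<Sum>i\<le>n. of_nat (n choose i) * euler_poly i a)"
    by (simp add: sum_distrib_left binomial_fact mult_ac)
  finally have "(- 1) ^ n * ((- 1) ^ n * euler_poly n (- a))
      = (- 1) ^ n * (\<Sum>i\<le>n. of_nat (n choose i) * euler_poly i a)"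
    by simp
  then show ?thesis
    by (simp flip: mult.assoc power_add add: mult_2[symmetric])
qed

definition euler_functional :: "'a::field_char_0 \<Rightarrow> 'a poly \<Rightarrow> 'a" where
  "euler_functional a p = (\<Sum>i\<le>degree p. coeff p i * euler_poly i a)"

text \<open>Coefficients beyond the degree vanish, so polynomials of different degrees can be summed
  over one common range; linearity rests on this.\<close>

lemma euler_functional_eq_sum:
  "degree p \<le> d \<Longrightarrow> euler_functional a p = (\<Sum>i\<le>d. coeff p i * euler_poly i a)"
  unfolding euler_functional_def
  by (rule sum.mono_neutral_left) (auto simp: coeff_eq_0)

lemma euler_functional_0 [simp]: "euler_functional a 0 = 0"
  by (simp add: euler_functional_def)

lemma euler_functional_add:
  "euler_functional a (p + r) = euler_functional a p + euler_functional a r"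
proof -
  define d where "d = max (degree p) (degree r)"
  have "degree p \<le> d" "degree r \<le> d" "degree (p + r) \<le> d"
    by (auto simp: d_def degree_add_le_max)
  then show ?thesis
    by (simp add: euler_functional_eq_sum sum.distrib distrib_right)
qed

lemma euler_functional_smult: "euler_functional a (smult c p) = c * euler_functional a p"
  by (simp add: euler_functional_eq_sum[of "smult c p" "degree p"] degree_smult_le
      euler_functional_def sum_distrib_left mult.assoc)

lemma euler_functional_sum:
  "euler_functional a (sum f A) = (\<Sum>x\<in>A. euler_functional a (f x))"
  by (induction A rule: infinite_finite_induct) (simp_all add: euler_functional_add)

lemma euler_functional_monom: "euler_functional a (monom c n) = c * euler_poly n a"
proof -
  have "euler_functional a (monom c n) = (\<Sum>i\<le>n. if i = n then c * euler_poly i a else 0)"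
    by (simp add: euler_functional_eq_sum[of _ n] degree_monom_le if_distrib[of "\<lambda>x. x * _"]
        eq_commute[of n] cong: if_cong)
  then show ?thesis
    by simp
qed

lemma one_plus_X_power: "[:1, 1:] ^ n = (\<Sum>i\<le>n. monom (of_nat (n choose i)) i :: 'a::comm_ring_1 poly)"
proof -
  have "[:1, 1:] = (monom 1 1 + 1 :: 'a poly)"
    by (simp add: monom_altdef one_pCons)
  then have "[:1, 1:] ^ n = (\<Sum>i\<le>n. of_nat (n choose i) * monom (1 :: 'a) 1 ^ i)"
    by (simp add: binomial_ring)
  then show ?thesis
    by (simp add: monom_power of_nat_poly smult_monom)
qed

text \<open>By linearity monomials suffice. There (-1 - x)^n = (-1)^n (1 + x)^n, and expanding (1 +
  x)^n produces exactly the binomial sum of \<open>euler_poly_minus\<close>.\<close>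

lemma euler_functional_reflect:
  "euler_functional (- a) p = euler_functional a (pcompose p [:- 1, - 1:])"
proof -
  have monom: "euler_functional (- a) (monom c n) = euler_functional a (pcompose (monom c n) [:- 1, - 1:])"
    for c n
  proof -
    have "pcompose (monom c n) [:- 1, - 1:] = smult c ([:- 1, - 1:] ^ n)"
      by (induction n) (simp_all add: monom_0 monom_Suc pcompose_pCons)
    also have "[:- 1, - 1:] = smult (- 1) [:1, 1 :: 'a:]"
      by simp
    also have "smult c (smult (- 1) [:1, 1:] ^ n) = smult (c * (- 1) ^ n) ([:1, 1:] ^ n)"
      by (simp only: smult_power smult_smult)
    finally show ?thesis
      by (simp add: one_plus_X_power euler_functional_smult euler_functional_sum
          euler_functional_monom euler_poly_minus)
  qed
  have "euler_functional (- a) (\<Sum>i\<le>degree p. monom (coeff p i) i)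
      = euler_functional a (pcompose (\<Sum>i\<le>degree p. monom (coeff p i) i) [:- 1, - 1:])"
    by (simp add: euler_functional_sum pcompose_sum monom)
  then show ?thesis
    by (simp add: poly_as_sum_of_monoms)
qed

lemma higher_pderiv_monom_binomial:
  "(pderiv ^^ k) (monom c n)
    = monom (fact k * of_nat (n choose k) * c :: 'a::field_char_0) (n - k)"
proof (induction k)
  case (Suc k)
  \<comment> \<open>Absorption; for k \<ge> n both sides are 0, so the truncated n - k does no
    harm.\<close>
  have "(of_nat (Suc k) * of_nat (n choose Suc k) :: 'a) = of_nat (n - k) * of_nat (n choose k)"
    by (metis binomial_absorb_comp binomial_absorption of_nat_mult)
  then have "of_nat (n - k) * (fact k * of_nat (n choose k) * c)
      = fact k * (of_nat (Suc k) * of_nat (n choose Suc k)) * c"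
    by (simp only: mult_ac)
  then show ?case
    by (simp add: Suc pderiv_monom mult_ac)
qed simp

text \<open>Chain rule: the inner polynomial -1 - x has derivative -1, which contributes one sign
  per differentiation.\<close>

lemma higher_pderiv_pcompose_reflect:
  fixes p :: "'a::field_char_0 poly"
  shows "(pderiv ^^ k) (pcompose p [:- 1, - 1:])
    = smult ((- 1) ^ k) (pcompose ((pderiv ^^ k) p) [:- 1, - 1:])"
  by (induction k) (simp_all add: pderiv_smult pderiv_pcompose pderiv_pCons pcompose_smult)

text \<open>Expanding (1 + x)^M leaves the monomials x^(N + i), and the k-th derivative of each
  supplies the second binomial coefficient and the factor k!.\<close>

lemma euler_functional_higher_pderiv:
  "euler_functional a ((pderiv ^^ k) (monom 1 N * [:1, 1:] ^ M))
    = fact k * (\<Sum>i=0..M. of_nat (M choose i) * of_nat ((N + i) choose k) * euler_poly (N + i - k) a)"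
  by (simp add: one_plus_X_power sum_distrib_left mult_monom higher_pderiv_sum
      higher_pderiv_monom_binomial euler_functional_sum euler_functional_monom
      atLeast0AtMost mult_ac)

lemma binomial_sum_euler_poly_minus:
  fixes a :: "'a::field_char_0"
  shows "(\<Sum>j=0..N. of_nat (N choose j) * of_nat ((M + j) choose k) * euler_poly (M + j - k) (- a))
    = (- 1) ^ (M + N + k)
        * (\<Sum>i=0..M. of_nat (M choose i) * of_nat ((N + i) choose k) * euler_poly (N + i - k) a)"
    (is "?S = _ * ?T")
proof -
  define P Q :: "'a poly"
    where "P = monom 1 N * [:1, 1:] ^ M" and "Q = monom 1 M * [:1, 1:] ^ N"
  \<comment> \<open>Under x -> -1 - x the factor x becomes -(1 + x) and the factor 1 + x becomes
    -x.\<close>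
  have "pcompose Q [:- 1, - 1:] = (- [:1, 1:]) ^ M * (- monom 1 1) ^ N"
  proof -
    have "pcompose (p ^ n) r = (pcompose p r) ^ n" for n and p r :: "'a poly"
      by (induction n) (simp_all add: pcompose_mult pcompose_1)
    moreover have "pcompose (monom 1 n) r = r ^ n" for n and r :: "'a poly"
      by (induction n) (simp_all add: monom_0 monom_Suc pcompose_pCons one_pCons)
    ultimately show ?thesis
      by (simp add: Q_def pcompose_mult pcompose_pCons monom_altdef)
  qed
  also have "\<dots> = smult ((- 1) ^ (M + N)) P"
  proof -
    have "(- p) ^ i = smult ((- 1) ^ i) (p ^ i)" for i and p :: "'a poly"
      by (cases "even i") simp_all
    then have "(- [:1, 1:]) ^ M * (- monom 1 1) ^ N
        = smult ((- 1) ^ M) ([:1, 1:] ^ M) * smult ((- 1) ^ N) (monom (1 :: 'a) 1 ^ N)"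
      by (simp only:)
    then show ?thesis
      by (simp only: P_def monom_power mult_smult_left mult_smult_right smult_smult power_add
          mult_ac mult_1 power_one mult_1_right)
  qed
  finally have refl: "pcompose Q [:- 1, - 1:] = smult ((- 1) ^ (M + N)) P" .
  \<comment> \<open>The sign (-1)^k is its own inverse, so it can be moved across the equation for
    the derivatives below.\<close>
  have sign: "(- 1) ^ k * (- 1) ^ k = (1 :: 'a)"
    by (simp flip: power_add add: mult_2[symmetric])
  have "(pderiv ^^ k) (smult ((- 1) ^ (M + N)) P)
      = smult ((- 1) ^ k) (pcompose ((pderiv ^^ k) Q) [:- 1, - 1:])"
    by (simp add: higher_pderiv_pcompose_reflect flip: refl)
  then have "pcompose ((pderiv ^^ k) Q) [:- 1, - 1:]
      = smult ((- 1) ^ (M + N + k)) ((pderiv ^^ k) P)"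
    using arg_cong[of _ _ "smult ((- 1) ^ k)"] sign
    by (metis (no_types, lifting) higher_pderiv_smult mult.commute power_add smult_1_left smult_smult)
  then have "euler_functional (- a) ((pderiv ^^ k) Q)
      = (- 1) ^ (M + N + k) * euler_functional a ((pderiv ^^ k) P)"
    by (simp only: euler_functional_reflect euler_functional_smult)
  then have "fact k * ?S = fact k * ((- 1) ^ (M + N + k) * ?T)"
    by (simp add: P_def Q_def euler_functional_higher_pderiv mult_ac)
  then show ?thesis
    by simp
qed

(* In each term whose index n + q + i - k (or m + q + j - k) would be negative,
   the natural-number subtraction truncates to 0, but the factor "choose k" is 0. *)
theorem theorem1p1:
  fixes k q m n :: nat and a :: complex
  assumes "k \<ge> 1" and "q \<ge> 1" and "odd k" and "m + n > 0"
  shows "(-1) ^ m * (\<Sum>i=0..m+q. of_nat ((m + q) choose i) * of_nat ((n + q + i) choose k)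
              * euler_poly (n + q + i - k) a)
       + (-1) ^ n * (\<Sum>j=0..n+q. of_nat ((n + q) choose j) * of_nat ((m + q + j) choose k)
              * euler_poly (m + q + j - k) (- a)) = 0"
proof -
  \<comment> \<open>The total exponent is m + 2(n + q) + k, and k is odd. Rewriting the sum at -a
    through the one at a thus gives it the coefficient -(-1)^m, opposite to that of the first
    sum.\<close>
  have "(- 1) ^ n * (- 1) ^ (m + q + (n + q) + k) = - ((- 1) ^ m :: complex)"
    using \<open>odd k\<close> by (cases "even m"; cases "even n") (simp_all add: power_add flip: power_mult_distrib)
  then show ?thesis
    by (simp only: binomial_sum_euler_poly_minus flip: mult.assoc) simp
qed

end
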